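(* Let $n\ge 5$ be an odd integer, let $W_n$ be the wheel graph with $n$ vertices, let $D$ be its distance matrix, and let $\widetilde{L}$ be the special Laplacian matrix of $W_n$ (both defined explicitly in the context). Then the Moore–Penrose inverse of $D$ is $$D^{\dagger}=-\frac12\,\widetilde{L}+\frac{4}{n-1}\,ww',$$ where $w=\frac14(5-n,1,\dots,1)'\in\mathbb{R}^n$.
   Context: Prime denotes transpose. $\mathbf 1$ is the all-ones column vector in $\mathbb{R}^{n-1}$. For a row vector $(x_1,\dots,x_r)$, $\mathrm{Circ}(x_1,\dots,x_r)$ is the $r\times r$ circulant matrix with first row $(x_1,\dots,x_r)$, each subsequent row being the cyclic right shift by one of the previous row. The wheel graph $W_n$ has a center vertex $w_1$ adjacent to all other vertices $w_2,\dots,w_n$, which form a cycle $w_2,w_3,\dots,w_n,w_2$ of length $n-1$. With this labelling its distance matrix is the $n\times n$ matrix $$D=\begin{bmatrix}0&\mathbf 1'\\ \mathbf 1&\widetilde D\end{bmatrix},\qquad \widetilde D=\mathrm{Circ}(u),\quad u=(0,1,2,\dots,2,1)\in\mathbb{R}^{n-1}.$$ Let $m=\frac{n-1}{2}$. For $k\in\{1,\dots,m\}$ let $c^k\in\mathbb{R}^{n-1}$ be the row vector whose $j$-th entry is $1$ if $j=k+1$ or $j=n-k$ and $0$ otherwise (for $k=m$ the two positions coincide), and let $C_k=\mathrm{Circ}(c^k)$. Let $$g(k)=\frac{n+(-1)^{m-k}}{2},\qquad \alpha_k=\frac{(-1)^{g(k)}\left(2m^2-6(m-k)^2+1\right)}{6(n-1)}.$$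 The special Laplacian of $W_n$ is the $n\times n$ matrix $$\widetilde L=\begin{bmatrix}\frac{n-1}{2}&-\frac12\mathbf 1'\\ -\frac12\mathbf 1&\frac{n(n-2)}{6(n-1)}I_{n-1}+\sum_{k=1}^m\alpha_kC_k\end{bmatrix}.$$ *)

theory Defs
  imports "Jordan_Normal_Form.Matrix" "Graph_Theory.Graph_Theory"
begin

section \<open>Moore--Penrose inverse\<close>

definition is_moore_penrose_inverse :: "real mat \<Rightarrow> real mat \<Rightarrow> bool" where
  "is_moore_penrose_inverse A X \<longleftrightarrow>
     X \<in> carrier_mat (dim_col A) (dim_row A) \<and>
     A * X * A = A \<and> X * A * X = X \<and>
     transpose_mat (A * X) = A * X \<and> transpose_mat (X * A) = X * A"

lemma moore_penrose_inverse_unique: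
  assumes "is_moore_penrose_inverse A X" "is_moore_penrose_inverse A Y"
  shows "X = Y"
proof -
  define m n where "m = dim_row A" and "n = dim_col A"
  have A: "A \<in> carrier_mat m n" by (simp add: m_def n_def)
  have X: "X \<in> carrier_mat n m" and X1: "A * X * A = A" and X2: "X * A * X = X"
    and X3: "transpose_mat (A * X) = A * X" and X4: "transpose_mat (X * A) = X * A"
    using assms(1) by (auto simp: is_moore_penrose_inverse_def m_def n_def)
  have Y: "Y \<in> carrier_mat n m" and Y1: "A * Y * A = A" and Y2: "Y * A * Y = Y"
    and Y3: "transpose_mat (A * Y) = A * Y" and Y4: "transpose_mat (Y * A) = Y * A"
    using assms(2) by (auto simp: is_moore_penrose_inverse_def m_def n_def)
  have AX: "A * X \<in> carrier_mat m m" and AY: "A * Y \<in> carrier_mat m m"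
    and XA: "X * A \<in> carrier_mat n n" and YA: "Y * A \<in> carrier_mat n n"
    using A X Y by auto
  have "A * X = (A * Y) * (A * X)"
    using assoc_mult_mat[OF AY A X] Y1 by simp
  then have "A * X = transpose_mat ((A * Y) * (A * X))" using X3 by simp
  also have "\<dots> = (A * X) * (A * Y)" by (simp add: transpose_mult[OF AY AX] X3 Y3)
  also have "\<dots> = A * Y" using assoc_mult_mat[OF AX A Y] X1 by simp
  finally have eq1: "A * X = A * Y" .
  have "X * A = (X * A) * (Y * A)"
    using assoc_mult_mat[OF X A YA] assoc_mult_mat[OF A Y A] Y1 by simp
  then have "X * A = transpose_mat ((X * A) * (Y * A))" using X4 by simp
  also have "\<dots> = (Y * A) * (X * A)" by (simp add: transpose_mult[OF XA YA] X4 Y4)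
  also have "\<dots> = Y * A" using assoc_mult_mat[OF Y A XA] assoc_mult_mat[OF A X A] X1 by simp
  finally have eq2: "X * A = Y * A" .
  have "X = X * A * Y" using assoc_mult_mat[OF X A X] assoc_mult_mat[OF X A Y] X2 eq1 by simp
  also have "\<dots> = Y" using eq2 Y2 by simp
  finally show ?thesis .
qed

section \<open>The wheel graph and its distance matrix\<close>

definition wheel_graph :: "nat \<Rightarrow> nat pair_pre_digraph" where
  "wheel_graph n = \<lparr> pverts = {1..n},
     parcs = {(1, i) | i. 2 \<le> i \<and> i \<le> n} \<union> {(i, 1) | i. 2 \<le> i \<and> i \<le> n}
           \<union> {(i, i + 1) | i. 2 \<le> i \<and> i < n} \<union> {(i + 1, i) | i. 2 \<le> i \<and> i < n}
           \<union> {(n, 2), (2, n)} \<rparr>"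

definition graph_dist :: "'a pair_pre_digraph \<Rightarrow> 'a \<Rightarrow> 'a \<Rightarrow> real" where
  "graph_dist G u v = real_of_ereal (wf_digraph.\<mu> (with_proj G) (\<lambda>_. 1) u v)"

text \<open>Matrix indices start at 0, vertex labels at 1.\<close>

definition wheel_dist_mat :: "nat \<Rightarrow> real mat" where
  "wheel_dist_mat n = mat n n (\<lambda>(i, j). graph_dist (wheel_graph n) (i + 1) (j + 1))"

definition circ :: "'a vec \<Rightarrow> 'a mat" where
  "circ v = (let r = dim_vec v in mat r r (\<lambda>(i, j). v $ ((j + r - i) mod r)))"

lemma circ_carrier [simp]: "circ v \<in> carrier_mat (dim_vec v) (dim_vec v)"
  by (simp add: circ_def Let_def)

lemma dim_circ [simp]: "dim_row (circ v) = dim_vec v" "dim_col (circ v) = dim_vec v"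
  by (simp_all add: circ_def Let_def)

lemma index_circ:
  "i < dim_vec v \<Longrightarrow> j < dim_vec v \<Longrightarrow>
     circ v $$ (i, j) = v $ ((j + dim_vec v - i) mod dim_vec v)"
  by (simp add: circ_def Let_def)

lemma pair_graph_wheel_graph:
  assumes "n \<ge> 4"
  shows "pair_graph (wheel_graph n)"
proof
  have sub: "parcs (wheel_graph n) \<subseteq> {1..n} \<times> {1..n}"
    using assms by (auto simp: wheel_graph_def)
  show "finite (parcs (wheel_graph n))"
    by (rule finite_subset[OF sub]) simp
  show "symmetric (with_proj (wheel_graph n))"
    by (auto simp: symmetric_def sym_def wheel_graph_def)
qed (use assms in \<open>auto simp: wheel_graph_def\<close>)

lemma graph_dist_wheel_graph:
  assumes n: "n \<ge> 4" and u: "u \<in> {1..n}" and v: "v \<in> {1..n}"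
  shows "graph_dist (wheel_graph n) u v =
    (if u = v then 0 else if (u, v) \<in> parcs (wheel_graph n) then 1 else 2)"
proof -
  interpret pair_graph "wheel_graph n" by (rule pair_graph_wheel_graph[OF n])
  define d :: nat where
    "d = (if u = v then 0 else if (u, v) \<in> parcs (wheel_graph n) then 1 else 2)"
  have cost: "awalk_cost (\<lambda>_. 1) p = real (length p)" for p :: "(nat \<times> nat) list"
    by (induction p) auto
  have lower: "d \<le> length p" if "awalk u p v" for p
  proof (cases p)
    case Nil
    with that show ?thesis by (simp add: awalk_def d_def)
  next
    case (Cons e q)
    with that have e: "e \<in> parcs (wheel_graph n)" "fst e = u" "pcas (snd e) q v"
      by (auto simp: awalk_def)
    show ?thesis
    proof (cases q)
      case Nil
      with e have "e = (u, v)" by (cases e) auto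
      with e Cons show ?thesis by (auto simp: d_def)
    next
      case (Cons f r)
      with \<open>p = e # q\<close> show ?thesis by (auto simp: d_def)
    qed
  qed
  have "\<exists>p. awalk u p v \<and> length p = d"
  proof (cases "u = v \<or> (u, v) \<in> parcs (wheel_graph n)")
    case True
    have verts: "u \<in> pverts (wheel_graph n)" using u by (simp add: wheel_graph_def)
    have "awalk u [] v \<and> length ([] :: (nat \<times> nat) list) = d" if "u = v"
      using that verts by (auto simp: awalk_def d_def)
    moreover have "awalk u [(u, v)] v \<and> length [(u, v)] = d" if "u \<noteq> v"
      using that verts True by (auto simp: awalk_def d_def)
    ultimately show ?thesis by blast
  next
    case False
    then have "u \<noteq> 1" "v \<noteq> 1" using u v by (auto simp: wheel_graph_def)
    then have "awalk u [(u, 1), (1, v)] v"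
      using u v unfolding awalk_def by (auto simp: wheel_graph_def)
    then show ?thesis using False by (intro exI[of _ "[(u, 1), (1, v)]"]) (simp add: d_def)
  qed
  then obtain p where p: "awalk u p v" "length p = d" by blast
  have "\<mu> (\<lambda>_. 1) u v = ereal (real d)"
    unfolding \<mu>_def cost
  proof (rule antisym)
    show "(INF p\<in>{p. awalk u p v}. ereal (real (length p))) \<le> ereal (real d)"
      using p by (intro INF_lower2[of p]) auto
    show "ereal (real d) \<le> (INF p\<in>{p. awalk u p v}. ereal (real (length p)))"
      using lower by (intro INF_greatest) auto
  qed
  then show ?thesis by (simp add: graph_dist_def d_def)
qed

lemma wheel_dist_mat_explicit:
  assumes n: "n \<ge> 4"
  shows "wheel_dist_mat n = four_block_mat
     (mat 1 1 (\<lambda>_. 0)) (mat 1 (n - 1) (\<lambda>_. 1))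
     (mat (n - 1) 1 (\<lambda>_. 1))
     (circ (vec (n - 1) (\<lambda>k. if k = 0 then 0 else if k = 1 \<or> k = n - 2 then 1 else 2)))"
    (is "_ = ?R")
proof (rule eq_matI)
  fix i j assume "i < dim_row ?R" "j < dim_col ?R"
  then have ij: "i < n" "j < n" using n by auto
  have L: "wheel_dist_mat n $$ (i, j) = (if i = j then 0
      else if (i + 1, j + 1) \<in> parcs (wheel_graph n) then 1 else 2)"
    using ij by (simp add: wheel_dist_mat_def graph_dist_wheel_graph[OF n])
  show "wheel_dist_mat n $$ (i, j) = ?R $$ (i, j)"
  proof (cases "i = 0 \<or> j = 0")
    case True
    then show ?thesis
      unfolding L using ij n by (auto simp: wheel_graph_def)
  next
    case False
    have m: "((j - 1) + (n - 1) - (i - 1)) mod (n - 1) =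
        (if i \<le> j then j - i else j + (n - 1) - i)"
    proof (cases "i \<le> j")
      case True
      then have "(j - 1) + (n - 1) - (i - 1) = (j - i) + (n - 1)" using False by simp
      moreover have "j - i < n - 1" using ij False by auto
      ultimately show ?thesis using True by (simp only: mod_add_self2 mod_less if_True)
    next
      case f: False
      then have "(j - 1) + (n - 1) - (i - 1) = j + (n - 1) - i" using False by simp
      moreover have "j + (n - 1) - i < n - 1" using f ij False by auto
      ultimately show ?thesis using f by (simp only: mod_less if_False)
    qed
    have lt: "(if i \<le> j then j - i else j + (n - 1) - i) < n - 1"
      using ij False by auto
    have arc: "(i + 1, j + 1) \<in> parcs (wheel_graph n) \<longleftrightarrow>
        j = i + 1 \<or> i = j + 1 \<or> (i = n - 1 \<and> j = 1) \<or> (i = 1 \<and> j = n - 1)"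
      using ij False n by (auto simp: wheel_graph_def)
    have "?R $$ (i, j) = circ (vec (n - 1)
        (\<lambda>k. if k = 0 then 0 else if k = 1 \<or> k = n - 2 then 1 else 2)) $$ (i - 1, j - 1)"
      using ij False n by simp
    also have "\<dots> = (let k = (if i \<le> j then j - i else j + (n - 1) - i) in
        if k = 0 then 0 else if k = 1 \<or> k = n - 2 then 1 else 2)"
    proof -
      have "i - 1 < n - 1" "j - 1 < n - 1" using ij False by auto
      then show ?thesis using lt by (simp only: index_circ dim_vec m index_vec Let_def)
    qed
    finally have "?R $$ (i, j) = (let k = (if i \<le> j then j - i else j + (n - 1) - i) in
        if k = 0 then 0 else if k = 1 \<or> k = n - 2 then 1 else 2)" .
    moreover have "(if i \<le> j then j - i else j + (n - 1) - i) = 0 \<longleftrightarrow> i = j"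
      using ij False by auto
    moreover have "(if i \<le> j then j - i else j + (n - 1) - i) = 1 \<or>
        (if i \<le> j then j - i else j + (n - 1) - i) = n - 2 \<longleftrightarrow>
        j = i + 1 \<or> i = j + 1 \<or> (i = n - 1 \<and> j = 1) \<or> (i = 1 \<and> j = n - 1)"
    proof (cases "i \<le> j")
      case True
      then obtain d where d: "j = i + d" using le_Suc_ex by blast
      have "d = n - 2 \<longleftrightarrow> i = 1 \<and> i + d = n - 1" using ij False n d by linarith
      moreover have "\<not> (i = n - 1 \<and> i + d = 1)" using n by linarith
      ultimately show ?thesis using d by auto
    next
      case f: False
      then obtain d where d: "i = j + d" "d > 0"
        by (metis less_imp_add_positive not_le)
      have "j + (n - 1) - i = n - 1 - d" using d by simp
      moreover have "n - 1 - d = 1 \<longleftrightarrow> j + d = n - 1 \<and> j = 1" using ij False n d by linarith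
      moreover have "n - 1 - d = n - 2 \<longleftrightarrow> d = 1" using n d by linarith
      ultimately show ?thesis using d by auto
    qed
    ultimately show ?thesis
      unfolding L arc Let_def by (simp only:)
  qed
qed (use n in \<open>auto simp: wheel_dist_mat_def\<close>)

section \<open>The special Laplacian and the vector \<open>w\<close>\<close>

text \<open>Position \<open>j\<close> of the row vector is index \<open>j - 1\<close>.\<close>

definition c_vec :: "nat \<Rightarrow> nat \<Rightarrow> real vec" where
  "c_vec n k = vec (n - 1) (\<lambda>i. let j = i + 1 in if j = k + 1 \<or> j = n - k then 1 else 0)"

text \<open>For odd \<open>n\<close> the integer division is exact.\<close>

definition g_exp :: "nat \<Rightarrow> nat \<Rightarrow> int" where
  "g_exp n k = (let m = (n - 1) div 2 in (int n + (-1) ^ (m - k)) div 2)"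

definition alpha :: "nat \<Rightarrow> nat \<Rightarrow> real" where
  "alpha n k = (let m = (n - 1) div 2 in
     (-1) powi (g_exp n k) * (2 * real m ^ 2 - 6 * (real m - real k) ^ 2 + 1)
       / (6 * (real n - 1)))"

text \<open>A sum of matrices is written entrywise, since the type of matrices of all dimensions
  is not an additive monoid.\<close>

definition special_laplacian :: "nat \<Rightarrow> real mat" where
  "special_laplacian n = (let m = (n - 1) div 2 in four_block_mat
     (mat 1 1 (\<lambda>_. (real n - 1) / 2)) (mat 1 (n - 1) (\<lambda>_. - 1 / 2))
     (mat (n - 1) 1 (\<lambda>_. - 1 / 2))
     ((real n * (real n - 2) / (6 * (real n - 1))) \<cdot>\<^sub>m 1\<^sub>m (n - 1)
      + mat (n - 1) (n - 1) (\<lambda>(i, j). \<Sum>k = 1..m. (alpha n k \<cdot>\<^sub>m circ (c_vec n k)) $$ (i, j))))"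

text \<open>The column vector \<open>w\<close> as an \<open>n \<times> 1\<close> matrix.\<close>

definition w_col :: "nat \<Rightarrow> real mat" where
  "w_col n = (1 / 4) \<cdot>\<^sub>m mat n 1 (\<lambda>(i, _). if i = 0 then 5 - real n else 1)"

end

theory Submission
  imports Defs
begin

text \<open>
  Write \<open>n = 2 m + 1\<close>, let \<open>D\<close> be the distance matrix and \<open>X\<close> the proposed inverse. The rim is an
  even cycle, so the vector \<open>z = (0, 1, -1, 1, -1, \<dots>)\<close>, which is zero at the hub and alternates along
  the rim, is well defined. It spans the kernel of \<open>D\<close>: a rim vertex has distance 2 to
  every rim vertex, less 2 for the vertex itself and less 1 for its two neighbours, and \<open>z\<close> is killed both
  by the constant part and by the \<open>(2, 1, 1)\<close> stencil. Let \<open>P = z z' / (2 m)\<close> be the orthogonal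
  projection onto \<open>z\<close>. All of \<open>D\<close>, \<open>X\<close>, \<open>P\<close> are symmetric, so the four Penrose equations follow
  from \<open>D X = I - P\<close>, \<open>D P = 0\<close> and \<open>X P = 0\<close>
  (\<open>moore_penrose_of_symmetric_projection\<close>).

  The point of the special Laplacian is that the diagonal entry of its rim block and the numbers
  \<open>\<alpha>\<^sub>k\<close> are values of a single function \<open>a(t) = (-1)\<^sup>t\<^sup>+\<^sup>1 (2 m\<^sup>2 - 6 (m - t)\<^sup>2 + 1) / (12 m)\<close>
  of the cyclic offset \<open>t\<close>, which is invariant under \<open>t \<mapsto> 2 m - t\<close>. Hence the rim block is the
  circulant matrix with first row \<open>a(0), \<dots>, a(2 m - 1)\<close>
  (\<open>special_laplacian_rim_entry\<close>). Up to its sign, \<open>a\<close> is quadratic, so the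
  stencil \<open>2 a(t) + a(t + 1) + a(t - 1)\<close> is \<open>(-1)\<^sup>t\<close> times a second difference of a quadratic. It is
  therefore a constant multiple of \<open>(-1)\<^sup>t\<close>, except at \<open>t = 0\<close>, where the reflected quadratic has a
  kink that contributes a point mass (\<open>lap_coeff_second_difference\<close>). The point mass becomes the
  identity matrix in \<open>D X\<close> and the alternating term becomes \<open>P\<close>. What is left over consists of
  constants, which cancel because \<open>a\<close> sums to \<open>1/2\<close> over a period and because of the rank one term
  \<open>w w'\<close>; and \<open>X P = 0\<close> because \<open>(-1)\<^sup>t a(t)\<close> sums to zero.
\<close>

section \<open>A criterion for symmetric matrices\<close>

text \<open>Symmetry turns \<open>A X = I - P\<close> into \<open>X A = I - P\<close> by transposition, so both products are
  symmetric; multiplying back by \<open>A\<close> or \<open>X\<close> loses only the terms \<open>A P\<close> and \<open>X P\<close>.\<close>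

lemma moore_penrose_of_symmetric_projection:
  assumes A: "A \<in> carrier_mat n n" and X: "X \<in> carrier_mat n n" and P: "P \<in> carrier_mat n n"
    and symA: "transpose_mat A = A" and symX: "transpose_mat X = X" and symP: "transpose_mat P = P"
    and AX: "A * X = 1\<^sub>m n - P" and AP: "A * P = 0\<^sub>m n n" and XP: "X * P = 0\<^sub>m n n"
  shows "is_moore_penrose_inverse A X"
proof -
  have symAX: "transpose_mat (A * X) = A * X"
    unfolding AX using P symP by (simp add: transpose_minus[of _ n n])
  have "X * A = transpose_mat (A * X)"
    by (simp add: transpose_mult[OF A X] symA symX)
  then have XA: "X * A = A * X" by (simp add: symAX)
  have "A * X * A = A * (X * A)" by (rule assoc_mult_mat[OF A X A])
  also have "\<dots> = A * 1\<^sub>m n - A * P"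
    unfolding XA AX by (rule mult_minus_distrib_mat[OF A _ P]) simp
  also have "\<dots> = A" using A by (intro eq_matI) (auto simp: AP)
  finally have AXA: "A * X * A = A" .
  have "X * A * X = X * (A * X)" by (rule assoc_mult_mat[OF X A X])
  also have "\<dots> = X * 1\<^sub>m n - X * P"
    unfolding AX by (rule mult_minus_distrib_mat[OF X _ P]) simp
  also have "\<dots> = X" using X by (intro eq_matI) (auto simp: XP)
  finally have XAX: "X * A * X = X" .
  show ?thesis
    unfolding is_moore_penrose_inverse_def using A X AXA XAX symAX by (simp add: XA)
qed

section \<open>Sums over circulant matrices\<close>

lemma cyclic_offset:
  fixes i k N :: nat
  assumes "i < N" "k < N"
  shows "(k + N - i) mod N = (if i \<le> k then k - i else k + N - i)"
proof (cases "i \<le> k")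
  case True
  then have "k + N - i = (k - i) + N" by simp
  moreover have "k - i < N" using assms by simp
  ultimately show ?thesis using True by (simp only: mod_add_self2 mod_less if_True)
qed (use assms in simp)

lemma cyclic_succ: "i < N \<Longrightarrow> Suc i mod N = (if Suc i = N then 0 else Suc i)" for i N :: nat
  by simp

lemma cyclic_pred: "i < N \<Longrightarrow> (i + N - 1) mod N = (if i = 0 then N - 1 else i - 1)" for i N :: nat
  using cyclic_offset[of 1 N i] by (cases "N = 1") auto

lemma cyclic_succ_iff_pred:
  assumes "i < N" "k < N"
  shows "k = Suc i mod N \<longleftrightarrow> i = (k + N - 1) mod N"
  unfolding cyclic_succ[OF assms(1)] cyclic_pred[OF assms(2)] using assms by auto

text \<open>For a fixed column \<open>j\<close>, passing from a row to its cyclic offset is an involution of the indices,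
  so sums along the column become sums over the defining vector.\<close>

lemma sum_circ_column:
  fixes v :: "real vec" and g :: "nat \<Rightarrow> real"
  assumes N: "dim_vec v = N" and j: "j < N"
  shows "(\<Sum>k<N. circ v $$ (k, j) * g k) = (\<Sum>t<N. v $ t * g ((j + N - t) mod N))"
proof -
  have inv: "(j + N - (j + N - k) mod N) mod N = k" if "k < N" for k
  proof -
    have "(j + N - k) mod N < N" using j by simp
    then show ?thesis
      using that j by (subst cyclic_offset) (auto simp: cyclic_offset)
  qed
  show ?thesis
    by (rule sum.reindex_bij_witness[of _ "\<lambda>t. (j + N - t) mod N" "\<lambda>k. (j + N - k) mod N"])
      (use inv j in \<open>auto simp: index_circ N\<close>)
qed

section \<open>The rim of the wheel\<close>

definition rim_dist :: "nat \<Rightarrow> real mat" where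
  "rim_dist N = circ (vec N (\<lambda>k. if k = 0 then 0 else if k = 1 \<or> k = N - 1 then 1 else 2))"

lemma rim_dist_entry:
  assumes N: "N \<ge> 4" and i: "i < N" and k: "k < N"
  shows "rim_dist N $$ (i, k) = 2 - 2 * of_bool (k = i)
      - of_bool (k = Suc i mod N) - of_bool (k = (i + N - 1) mod N)"
proof -
  have "rim_dist N $$ (i, k) = (let t = (k + N - i) mod N in
      if t = 0 then 0 else if t = 1 \<or> t = N - 1 then 1 else 2)"
    using N i k by (simp add: rim_dist_def index_circ Let_def)
  then show ?thesis
    unfolding Let_def cyclic_offset[OF i k] cyclic_succ[OF i] cyclic_pred[OF i]
    using N i k by (auto split: if_splits)
qed

text \<open>A row of the rim block acts as twice the total sum, corrected by the stencil that weights a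
  vertex with 2 and each of its neighbours on the cycle with 1. The rim rows of all later products with the distance
  matrix are evaluated through this.\<close>

lemma rim_dist_row_sum:
  fixes f :: "nat \<Rightarrow> real"
  assumes N: "N \<ge> 4" and i: "i < N"
  shows "(\<Sum>k<N. rim_dist N $$ (i, k) * f k)
    = 2 * (\<Sum>k<N. f k) - 2 * f i - f (Suc i mod N) - f ((i + N - 1) mod N)"
proof -
  have pick: "(\<Sum>k<N. of_bool (k = l) * f k) = f l" if "l < N" for l
    using that by (simp add: of_bool_def if_distrib[of "\<lambda>x. x * _"] cong: if_cong)
  have "(\<Sum>k<N. rim_dist N $$ (i, k) * f k) = (\<Sum>k<N. 2 * f k - 2 * (of_bool (k = i) * f k)
      - of_bool (k = Suc i mod N) * f k - of_bool (k = (i + N - 1) mod N) * f k)"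
    by (rule sum.cong) (simp_all add: rim_dist_entry[OF N i] algebra_simps)
  also have "\<dots> = 2 * (\<Sum>k<N. f k) - 2 * f i - f (Suc i mod N) - f ((i + N - 1) mod N)"
    using i by (simp only: sum_subtractf sum_distrib_left[symmetric] pick) (simp add: pick)
  finally show ?thesis .
qed

section \<open>The coefficients of the special Laplacian\<close>

text \<open>The function of the cyclic offset \<open>t\<close> that gives \<open>\<alpha>\<^sub>t\<close> for \<open>1 \<le> t \<le> m\<close> and the diagonal
  entry \<open>n (n - 2) / (6 (n - 1))\<close> for \<open>t = 0\<close>.\<close>

definition lap_coeff :: "nat \<Rightarrow> nat \<Rightarrow> real" where
  "lap_coeff m t =
     (- 1) ^ (t + 1) * (2 * real m ^ 2 - 6 * (real m - real t) ^ 2 + 1) / (12 * real m)"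

lemma lap_coeff_reflect: "t \<le> 2 * m \<Longrightarrow> lap_coeff m (2 * m - t) = lap_coeff m t"
proof -
  assume t: "t \<le> 2 * m"
  have "even (2 * m - t + 1) \<longleftrightarrow> even (t + 1)" using t by auto
  then have "(- 1 :: real) ^ (2 * m - t + 1) = (- 1) ^ (t + 1)"
    by (simp only: minus_one_power_iff)
  then show ?thesis using t by (simp add: lap_coeff_def power2_commute of_nat_diff)
qed

text \<open>The exponent \<open>g(k)\<close> is \<open>m + 1\<close> or \<open>m\<close> according to whether \<open>m - k\<close> is even or odd, and in
  both cases it has the parity of \<open>k + 1\<close>.\<close>

lemma alpha_eq_lap_coeff:
  assumes "k \<le> m"
  shows "alpha (Suc (2 * m)) k = lap_coeff m k"
proof -
  obtain d where d: "m = k + d" using assms le_Suc_ex by blast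
  have g: "g_exp (Suc (2 * m)) k = (if even d then int m + 1 else int m)"
    by (auto simp: g_exp_def d minus_one_power_iff)
  have "(- 1 :: real) powi (g_exp (Suc (2 * m)) k) = (- 1) ^ (k + 1)"
    unfolding g by (auto simp: d power_int_add power_int_minus_one_minus minus_one_power_iff)
  then show ?thesis by (simp add: alpha_def lap_coeff_def)
qed

lemma lap_coeff_zero:
  assumes "m > 0"
  shows "lap_coeff m 0 = (2 * real m + 1) * (2 * real m - 1) / (12 * real m)"
  using assms by (simp add: lap_coeff_def field_simps power2_eq_square)

text \<open>The reason for the shape of the coefficients. Away from \<open>t = 0\<close> the signs alternate, so the left
  side is \<open>(-1)\<^sup>t\<close> times a second difference of a quadratic. At \<open>t = 0\<close> both neighbours have the value at 1,
  because of the reflection, and the resulting kink produces the point mass.\<close>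

lemma lap_coeff_second_difference:
  assumes m: "m \<ge> 1" and t: "t < 2 * m"
  shows "2 * lap_coeff m t + lap_coeff m (Suc t mod (2 * m))
      + lap_coeff m ((t + 2 * m - 1) mod (2 * m))
    = 2 * of_bool (t = 0) - (- 1) ^ t / real m"
proof -
  have succ: "lap_coeff m (Suc t mod (2 * m)) = lap_coeff m (Suc t)"
    using lap_coeff_reflect[of 0 m] t by (auto simp: cyclic_succ)
  have pred: "lap_coeff m ((t + 2 * m - 1) mod (2 * m)) = (if t = 0 then lap_coeff m 1 else lap_coeff m (t - 1))"
    using lap_coeff_reflect[of 1 m] m t by (auto simp: cyclic_pred simp del: One_nat_def)
  show ?thesis
    unfolding succ pred using m by (cases t) (auto simp: lap_coeff_def field_simps power2_eq_square)
qed

lemma lap_coeff_sum: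
  assumes "m \<ge> 1"
  shows "(\<Sum>t<2*m. lap_coeff m t) = 1 / 2"
proof -
  (* With F(t) = (-1)^t q(t) / (12 m), the difference F(t+1) - F(t) equals
     (-1)^(t+1) (q(t) + q(t+1)) / (12 m); q is the quadratic for which q(t) + q(t+1) = 2 m^2 - 6 (m - t)^2 + 1. *)
  define q where "q = (\<lambda>t::real. - 3 * t^2 + (6 * real m + 3) * t + (1 - 4 * real m ^ 2 - 6 * real m) / 2)"
  define F where "F = (\<lambda>t::nat. (- 1) ^ t * q (real t) / (12 * real m))"
  have "lap_coeff m t = F (Suc t) - F t" for t
    using assms by (simp add: lap_coeff_def F_def q_def field_simps power2_eq_square)
  then have "(\<Sum>t<2*m. lap_coeff m t) = F (2 * m) - F 0"
    by (simp add: sum_lessThan_telescope)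
  also have "\<dots> = 1 / 2"
    using assms by (simp add: F_def q_def field_simps power2_eq_square)
  finally show ?thesis .
qed

lemma lap_coeff_alternating_sum: "(\<Sum>t<2*m. lap_coeff m t * (- 1) ^ t) = 0"
proof -
  (* A polynomial antidifference of -(2 m^2 - 6 (m - t)^2 + 1) / (12 m); it vanishes at 0 and at 2 m. *)
  define F where "F = (\<lambda>t::real. (2 * t^3 - (6 * real m + 3) * t^2 + (4 * real m ^ 2 + 6 * real m) * t) / (12 * real m))"
  have "lap_coeff m t * (- 1) ^ t = - ((2 * real m ^ 2 - 6 * (real m - real t) ^ 2 + 1) / (12 * real m))" for t
    by (cases "even t") (simp_all add: lap_coeff_def add_divide_distrib diff_divide_distrib)
  moreover have "- ((2 * real m ^ 2 - 6 * (real m - real t) ^ 2 + 1) / (12 * real m)) = F (real (Suc t)) - F (real t)" for t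
    unfolding F_def diff_divide_distrib[symmetric] minus_divide_left
    by (rule arg_cong[where f = "\<lambda>x. x / (12 * real m)"]) (simp add: algebra_simps power2_eq_square power3_eq_cube)
  ultimately have "(\<Sum>t<2*m. lap_coeff m t * (- 1) ^ t) = F (real (2 * m)) - F (real 0)"
    using sum_lessThan_telescope[of "\<lambda>t. F (real t)" "2 * m"] by simp
  also have "\<dots> = 0"
    by (simp add: F_def algebra_simps power2_eq_square power3_eq_cube)
  finally show ?thesis .
qed

section \<open>The rim block of the special Laplacian\<close>

definition rim_lap :: "nat \<Rightarrow> real mat" where
  "rim_lap m = circ (vec (2 * m) (lap_coeff m))"

lemma rim_lap_entry:
  "i < 2 * m \<Longrightarrow> j < 2 * m \<Longrightarrow> rim_lap m $$ (i, j) = lap_coeff m ((j + 2 * m - i) mod (2 * m))"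
  by (simp add: rim_lap_def index_circ)

lemma rim_lap_sym:
  assumes "i < 2 * m" "j < 2 * m"
  shows "rim_lap m $$ (i, j) = rim_lap m $$ (j, i)"
proof -
  have *: "rim_lap m $$ (i, j) = rim_lap m $$ (j, i)" if "i < j" "j < 2 * m" for i j
  proof -
    have "2 * m - (j - i) = i + 2 * m - j" using that by simp
    then have "lap_coeff m (i + 2 * m - j) = lap_coeff m (j - i)"
      using lap_coeff_reflect[of "j - i" m] that by simp
    then show ?thesis using that by (simp add: rim_lap_entry cyclic_offset)
  qed
  show ?thesis using *[of i j] *[of j i] assms by (cases i j rule: linorder_cases) auto
qed

lemma rim_lap_column_sum:
  assumes "m \<ge> 1" "j < 2 * m"
  shows "(\<Sum>k<2*m. rim_lap m $$ (k, j)) = 1 / 2"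
  using sum_circ_column[of "vec (2 * m) (lap_coeff m)" "2 * m" j "\<lambda>_. 1"] lap_coeff_sum assms
  by (simp add: rim_lap_def)

lemma rim_lap_alternating_column_sum:
  assumes "j < 2 * m"
  shows "(\<Sum>k<2*m. rim_lap m $$ (k, j) * (- 1) ^ k) = 0"
proof -
  (* The cycle has even length, so reducing an offset modulo 2 m preserves its parity. *)
  have sgn: "(- 1 :: real) ^ ((j + 2 * m - t) mod (2 * m)) = (- 1) ^ j * (- 1) ^ t" if "t < 2 * m" for t
  proof -
    have "even ((j + 2 * m - t) mod (2 * m)) \<longleftrightarrow> even (j + t)"
      using that assms by (simp add: cyclic_offset)
    then show ?thesis by (auto simp: minus_one_power_iff)
  qed
  have "(\<Sum>k<2*m. rim_lap m $$ (k, j) * (- 1) ^ k)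
      = (\<Sum>t<2*m. lap_coeff m t * (- 1) ^ ((j + 2 * m - t) mod (2 * m)))"
    using sum_circ_column[of "vec (2 * m) (lap_coeff m)" "2 * m" j "\<lambda>k. (- 1) ^ k"] assms
    by (simp add: rim_lap_def)
  also have "\<dots> = (\<Sum>t<2*m. (- 1) ^ j * (lap_coeff m t * (- 1) ^ t))"
    by (rule sum.cong) (simp_all add: sgn)
  also have "\<dots> = (- 1) ^ j * (\<Sum>t<2*m. lap_coeff m t * (- 1) ^ t)"
    by (rule sum_distrib_left[symmetric])
  finally show ?thesis by (simp add: lap_coeff_alternating_sum)
qed

text \<open>Applying the stencil to column \<open>j\<close> of the Laplacian block at row \<open>i\<close> is applying it to the
  coefficients at the offset \<open>t = j - i\<close>, where it is known from \<open>lap_coeff_second_difference\<close>.\<close>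

lemma rim_dist_mult_rim_lap:
  assumes m: "m \<ge> 2" and i: "i < 2 * m" and j: "j < 2 * m"
  shows "(\<Sum>k<2*m. rim_dist (2*m) $$ (i, k) * rim_lap m $$ (k, j))
    = 1 - 2 * of_bool (i = j) + (- 1) ^ (i + j) / real m"
proof -
  define t where "t = (j + 2 * m - i) mod (2 * m)"
  have t: "t < 2 * m" using i by (simp add: t_def)
  have t0: "t = 0 \<longleftrightarrow> i = j" using i j by (auto simp: t_def cyclic_offset)
  have sgn: "(- 1 :: real) ^ t = (- 1) ^ (i + j)"
  proof -
    have "even t \<longleftrightarrow> even (i + j)"
      using i j by (simp add: t_def cyclic_offset) blast
    then show ?thesis by (simp only: minus_one_power_iff)
  qed
  (* Moving the row index forward moves the offset backward, and conversely. *)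
  have succ: "(j + 2 * m - Suc i mod (2 * m)) mod (2 * m) = (t + 2 * m - 1) mod (2 * m)"
  proof -
    have "Suc i mod (2 * m) < 2 * m" using i by simp
    then show ?thesis
      unfolding cyclic_offset[OF _ j] cyclic_pred[OF t] using i j
      by (auto simp: t_def cyclic_succ cyclic_offset)
  qed
  have pred: "(j + 2 * m - (i + 2 * m - 1) mod (2 * m)) mod (2 * m) = Suc t mod (2 * m)"
  proof -
    have "(i + 2 * m - 1) mod (2 * m) < 2 * m" using i by simp
    then show ?thesis
      unfolding cyclic_offset[OF _ j] cyclic_succ[OF t] using i j
      by (auto simp: t_def cyclic_pred cyclic_offset)
  qed
  have "(\<Sum>k<2*m. rim_dist (2*m) $$ (i, k) * rim_lap m $$ (k, j))
      = 2 * (\<Sum>k<2*m. rim_lap m $$ (k, j)) - 2 * rim_lap m $$ (i, j)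
        - rim_lap m $$ (Suc i mod (2 * m), j) - rim_lap m $$ ((i + 2 * m - 1) mod (2 * m), j)"
    using m i by (intro rim_dist_row_sum) auto
  also have "(\<Sum>k<2*m. rim_lap m $$ (k, j)) = 1 / 2"
    using m j by (intro rim_lap_column_sum) auto
  finally have "(\<Sum>k<2*m. rim_dist (2*m) $$ (i, k) * rim_lap m $$ (k, j))
      = 1 - 2 * lap_coeff m t - lap_coeff m ((t + 2 * m - 1) mod (2 * m)) - lap_coeff m (Suc t mod (2 * m))"
    using i j by (simp add: rim_lap_entry succ pred t_def[symmetric] del: One_nat_def)
  then show ?thesis
    using lap_coeff_second_difference[OF _ t] m by (simp add: t0 sgn)
qed

text \<open>The matrix \<open>C\<^sub>k\<close> has ones exactly at the offsets \<open>k\<close> and \<open>2 m - k\<close>, so an entry at offset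
  \<open>t \<noteq> 0\<close> collects a single coefficient, which is the one at \<open>t\<close> by reflection. The identity matrix
  contributes the coefficient at offset 0.\<close>

lemma special_laplacian_rim_entry:
  assumes m: "m \<ge> 1" and i: "i < 2 * m" and j: "j < 2 * m"
  shows "special_laplacian (Suc (2 * m)) $$ (Suc i, Suc j) = rim_lap m $$ (i, j)"
proof -
  define t where "t = (j + 2 * m - i) mod (2 * m)"
  have t: "t < 2 * m" using i by (simp add: t_def)
  have t0: "i = j \<longleftrightarrow> t = 0" using i j by (auto simp: t_def cyclic_offset)
  have "special_laplacian (Suc (2 * m)) $$ (Suc i, Suc j)
      = lap_coeff m 0 * of_bool (t = 0)
        + (\<Sum>k=1..m. lap_coeff m k * of_bool (t = k \<or> t = 2 * m - k))"
  proof -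
    have "circ (c_vec (Suc (2 * m)) k) $$ (i, j) = of_bool (t = k \<or> t = 2 * m - k)" if "k \<in> {1..m}" for k
      using i j t that by (simp add: index_circ c_vec_def t_def[symmetric] Let_def) auto
    then have "(\<Sum>k=1..m. (alpha (Suc (2 * m)) k \<cdot>\<^sub>m circ (c_vec (Suc (2 * m)) k)) $$ (i, j))
        = (\<Sum>k=1..m. lap_coeff m k * of_bool (t = k \<or> t = 2 * m - k))"
      using i j alpha_eq_lap_coeff by (intro sum.cong) (auto simp: c_vec_def)
    then show ?thesis
      using i j m by (simp add: special_laplacian_def Let_def t0 lap_coeff_zero)
  qed
  also have "\<dots> = lap_coeff m t"
  proof (cases "t = 0")
    case True
    then have "(\<Sum>k=1..m. lap_coeff m k * of_bool (t = k \<or> t = 2 * m - k)) = 0"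
      by (intro sum.neutral) auto
    with True show ?thesis by simp
  next
    case False
    (* The only k in {1..m} with a one at offset t; for t = m the two positions coincide. *)
    define s where "s = min t (2 * m - t)"
    have s: "s \<in> {1..m}" using False t by (auto simp: s_def)
    have "(\<Sum>k=1..m. lap_coeff m k * of_bool (t = k \<or> t = 2 * m - k)) = (\<Sum>k=1..m. if k = s then lap_coeff m k else 0)"
      by (rule sum.cong) (use t in \<open>auto simp: s_def min_def\<close>)
    also have "\<dots> = lap_coeff m s" using s by simp
    also have "\<dots> = lap_coeff m t" using lap_coeff_reflect[of t m] t by (auto simp: s_def min_def)
    finally show ?thesis using False by simp
  qed
  also have "\<dots> = rim_lap m $$ (i, j)" using i j by (simp add: rim_lap_entry t_def)
  finally show ?thesis .
qed

section \<open>The Moore--Penrose inverse\<close>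

text \<open>The proposed inverse, with the Laplacian and the rank one matrix added up entry by entry.\<close>

definition wheel_pinv :: "nat \<Rightarrow> real mat" where
  "wheel_pinv m = mat (Suc (2 * m)) (Suc (2 * m)) (\<lambda>(i, j).
     if i = 0 \<and> j = 0 then 2 / real m - 2
     else if i = 0 \<or> j = 0 then 1 / (2 * real m)
     else 1 / (8 * real m) - rim_lap m $$ (i - 1, j - 1) / 2)"

lemma special_laplacian_border:
  assumes "m \<ge> 1"
  shows "special_laplacian (Suc (2 * m)) $$ (0, 0) = real m"
    "j < 2 * m \<Longrightarrow> special_laplacian (Suc (2 * m)) $$ (0, Suc j) = - 1 / 2"
    "j < 2 * m \<Longrightarrow> special_laplacian (Suc (2 * m)) $$ (Suc j, 0) = - 1 / 2"
  using assms by (simp_all add: special_laplacian_def Let_def)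

lemma wheel_pinv_eq:
  assumes m: "m \<ge> 1"
  shows "(- 1 / 2) \<cdot>\<^sub>m special_laplacian (Suc (2 * m))
      + (4 / (real (Suc (2 * m)) - 1)) \<cdot>\<^sub>m (w_col (Suc (2 * m)) * transpose_mat (w_col (Suc (2 * m))))
    = wheel_pinv m" (is "?L + ?W = _")
proof (rule eq_matI)
  have dim: "dim_row (special_laplacian (Suc (2 * m))) = Suc (2 * m)" "dim_col (special_laplacian (Suc (2 * m))) = Suc (2 * m)"
    by (simp_all add: special_laplacian_def Let_def)
  show "dim_row (?L + ?W) = dim_row (wheel_pinv m)" "dim_col (?L + ?W) = dim_col (wheel_pinv m)"
    by (simp_all add: wheel_pinv_def w_col_def)
  fix i j assume "i < dim_row (wheel_pinv m)" "j < dim_col (wheel_pinv m)"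
  then have ij: "i < Suc (2 * m)" "j < Suc (2 * m)" by (simp_all add: wheel_pinv_def)
  have "(?L + ?W) $$ (i, j) = - special_laplacian (Suc (2 * m)) $$ (i, j) / 2
      + (if i = 0 then 4 - 2 * real m else 1) * (if j = 0 then 4 - 2 * real m else 1) / (8 * real m)"
    using ij dim by (auto simp: w_col_def scalar_prod_def field_simps)
  also have "\<dots> = wheel_pinv m $$ (i, j)"
    using ij m by (cases i; cases j)
      (simp_all add: wheel_pinv_def special_laplacian_border[OF m] special_laplacian_rim_entry[OF m],
        simp_all add: field_simps power2_eq_square)
  finally show "(?L + ?W) $$ (i, j) = wheel_pinv m $$ (i, j)" .
qed

text \<open>The orthogonal projection onto the vector that is 0 at the hub and alternates along the rim.\<close>

definition rim_projection :: "nat \<Rightarrow> real mat" where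
  "rim_projection m = mat (Suc (2 * m)) (Suc (2 * m)) (\<lambda>(i, j).
     if i = 0 \<or> j = 0 then 0 else (- 1) ^ (i + j) / (2 * real m))"

lemma wheel_dist_mat_entries:
  assumes m: "m \<ge> 2"
  shows "wheel_dist_mat (Suc (2 * m)) $$ (0, 0) = 0"
    "j < 2 * m \<Longrightarrow> wheel_dist_mat (Suc (2 * m)) $$ (0, Suc j) = 1"
    "i < 2 * m \<Longrightarrow> wheel_dist_mat (Suc (2 * m)) $$ (Suc i, 0) = 1"
    "i < 2 * m \<Longrightarrow> j < 2 * m \<Longrightarrow> wheel_dist_mat (Suc (2 * m)) $$ (Suc i, Suc j) = rim_dist (2 * m) $$ (i, j)"
proof -
  have "Suc (2 * m) - 2 = 2 * m - 1" by simp
  then show "wheel_dist_mat (Suc (2 * m)) $$ (0, 0) = 0"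
    "j < 2 * m \<Longrightarrow> wheel_dist_mat (Suc (2 * m)) $$ (0, Suc j) = 1"
    "i < 2 * m \<Longrightarrow> wheel_dist_mat (Suc (2 * m)) $$ (Suc i, 0) = 1"
    "i < 2 * m \<Longrightarrow> j < 2 * m \<Longrightarrow> wheel_dist_mat (Suc (2 * m)) $$ (Suc i, Suc j) = rim_dist (2 * m) $$ (i, j)"
    using wheel_dist_mat_explicit[of "Suc (2 * m)"] m by (simp_all only:) (simp_all add: rim_dist_def)
qed

lemma mult_entry_split_hub:
  assumes "A \<in> carrier_mat (Suc (2 * m)) (Suc (2 * m))" "B \<in> carrier_mat (Suc (2 * m)) (Suc (2 * m))"
    and "i < Suc (2 * m)" "j < Suc (2 * m)"
  shows "(A * B) $$ (i, j) = A $$ (i, 0) * B $$ (0, j) + (\<Sum>k<2*m. A $$ (i, Suc k) * B $$ (Suc k, j))"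
proof -
  have "(A * B) $$ (i, j) = (\<Sum>k<Suc (2 * m). A $$ (i, k) * B $$ (k, j))"
    using assms by (simp add: scalar_prod_def atLeast0LessThan)
  then show ?thesis by (simp only: sum.lessThan_Suc_shift)
qed

lemma alternating_sum_even: "(\<Sum>k<2*m. (- 1 :: real) ^ k) = 0"
  by (induction m) auto

context
  fixes m :: nat and D X P :: "real mat"
  assumes m: "m \<ge> 2"
  defines "D \<equiv> wheel_dist_mat (Suc (2 * m))" and "X \<equiv> wheel_pinv m" and "P \<equiv> rim_projection m"
begin

lemma wheel_dist_mat_carrier: "D \<in> carrier_mat (Suc (2 * m)) (Suc (2 * m))"
  by (simp add: D_def wheel_dist_mat_def)

lemma wheel_pinv_carrier: "X \<in> carrier_mat (Suc (2 * m)) (Suc (2 * m))"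
  by (simp add: X_def wheel_pinv_def)

lemma rim_projection_carrier: "P \<in> carrier_mat (Suc (2 * m)) (Suc (2 * m))"
  by (simp add: P_def rim_projection_def)

lemmas dist_entries = wheel_dist_mat_entries[OF m, folded D_def]

lemma wheel_pinv_entries:
  "X $$ (0, 0) = 2 / real m - 2"
  "j < 2 * m \<Longrightarrow> X $$ (0, Suc j) = 1 / (2 * real m)"
  "i < 2 * m \<Longrightarrow> X $$ (Suc i, 0) = 1 / (2 * real m)"
  "i < 2 * m \<Longrightarrow> j < 2 * m \<Longrightarrow> X $$ (Suc i, Suc j) = 1 / (8 * real m) - rim_lap m $$ (i, j) / 2"
  by (simp_all add: X_def wheel_pinv_def)

lemma rim_projection_entries:
  "j < Suc (2 * m) \<Longrightarrow> P $$ (0, j) = 0"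
  "i < Suc (2 * m) \<Longrightarrow> P $$ (i, 0) = 0"
  "i < 2 * m \<Longrightarrow> j < 2 * m \<Longrightarrow> P $$ (Suc i, Suc j) = (- 1) ^ i * (- 1) ^ j / (2 * real m)"
  by (simp_all add: P_def rim_projection_def power_add)

lemma wheel_dist_mat_symmetric: "transpose_mat D = D"
proof (rule eq_matI)
  fix i j assume "i < dim_row D" "j < dim_col D"
  then have ij: "i < Suc (2 * m)" "j < Suc (2 * m)" using wheel_dist_mat_carrier by auto
  have rim: "rim_dist (2 * m) $$ (k, l) = rim_dist (2 * m) $$ (l, k)" if "k < 2 * m" "l < 2 * m" for k l
    using m that cyclic_succ_iff_pred[OF that] cyclic_succ_iff_pred[OF that(2,1)]
    by (simp add: rim_dist_entry eq_commute[of k l] del: One_nat_def)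
  show "transpose_mat D $$ (i, j) = D $$ (i, j)"
    using ij wheel_dist_mat_carrier by (cases i; cases j) (auto simp: dist_entries rim)
qed (use wheel_dist_mat_carrier in auto)

lemma wheel_pinv_symmetric: "transpose_mat X = X"
proof (rule eq_matI)
  fix i j assume "i < dim_row X" "j < dim_col X"
  then have ij: "i < Suc (2 * m)" "j < Suc (2 * m)" using wheel_pinv_carrier by auto
  show "transpose_mat X $$ (i, j) = X $$ (i, j)"
    using ij wheel_pinv_carrier rim_lap_sym by (cases i; cases j) (auto simp: wheel_pinv_entries)
qed (use wheel_pinv_carrier in auto)

lemma rim_projection_symmetric: "transpose_mat P = P"
  by (rule eq_matI) (auto simp: P_def rim_projection_def add.commute)

lemma mult_rim_projection_eq_0:
  assumes A: "A \<in> carrier_mat (Suc (2 * m)) (Suc (2 * m))"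
    and null: "\<And>i. i < Suc (2 * m) \<Longrightarrow> (\<Sum>k<2*m. A $$ (i, Suc k) * (- 1) ^ k) = 0"
  shows "A * P = 0\<^sub>m (Suc (2 * m)) (Suc (2 * m))"
proof (rule eq_matI)
  fix i j assume "i < dim_row (0\<^sub>m (Suc (2 * m)) (Suc (2 * m)) :: real mat)"
    and "j < dim_col (0\<^sub>m (Suc (2 * m)) (Suc (2 * m)) :: real mat)"
  then have ij: "i < Suc (2 * m)" "j < Suc (2 * m)" by auto
  have "(A * P) $$ (i, j) = (\<Sum>k<2*m. A $$ (i, Suc k) * P $$ (Suc k, j))"
    using ij by (simp add: mult_entry_split_hub[OF A rim_projection_carrier] rim_projection_entries)
  also have "\<dots> = 0"
  proof (cases j)
    case (Suc l)
    then have "(\<Sum>k<2*m. A $$ (i, Suc k) * P $$ (Suc k, j))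
        = (\<Sum>k<2*m. A $$ (i, Suc k) * (- 1) ^ k) * ((- 1) ^ l / (2 * real m))"
      unfolding sum_distrib_right using ij by (intro sum.cong) (auto simp: rim_projection_entries)
    then show ?thesis using null[OF ij(1)] by simp
  qed (simp add: rim_projection_entries)
  finally show "(A * P) $$ (i, j) = 0\<^sub>m (Suc (2 * m)) (Suc (2 * m)) $$ (i, j)" using ij by simp
qed (use A rim_projection_carrier in auto)

lemma wheel_dist_mat_mult_rim_projection: "D * P = 0\<^sub>m (Suc (2 * m)) (Suc (2 * m))"
proof (rule mult_rim_projection_eq_0[OF wheel_dist_mat_carrier])
  fix i assume i: "i < Suc (2 * m)"
  show "(\<Sum>k<2*m. D $$ (i, Suc k) * (- 1) ^ k) = 0"
  proof (cases i)
    case 0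
    then show ?thesis using alternating_sum_even by (simp add: dist_entries)
  next
    case (Suc l)
    then have l: "l < 2 * m" using i by simp
    have "even (Suc l mod (2 * m)) \<longleftrightarrow> odd l" "even ((l + 2 * m - 1) mod (2 * m)) \<longleftrightarrow> odd l"
      using cyclic_succ[OF l] cyclic_pred[OF l] l
      by (metis dvd_triv_left even_Suc even_zero, auto simp del: One_nat_def)
    then have nbr: "(- 1 :: real) ^ (Suc l mod (2 * m)) = - ((- 1) ^ l)"
      "(- 1 :: real) ^ ((l + 2 * m - 1) mod (2 * m)) = - ((- 1) ^ l)"
      by (simp_all only: minus_one_power_iff) auto
    have "(\<Sum>k<2*m. D $$ (i, Suc k) * (- 1) ^ k) = (\<Sum>k<2*m. rim_dist (2 * m) $$ (l, k) * (- 1) ^ k)"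
      using Suc l by (simp add: dist_entries)
    also have "\<dots> = 0"
      using m l by (subst rim_dist_row_sum) (simp_all add: nbr alternating_sum_even del: One_nat_def)
    finally show ?thesis .
  qed
qed

lemma wheel_pinv_mult_rim_projection: "X * P = 0\<^sub>m (Suc (2 * m)) (Suc (2 * m))"
proof (rule mult_rim_projection_eq_0[OF wheel_pinv_carrier])
  fix i assume i: "i < Suc (2 * m)"
  show "(\<Sum>k<2*m. X $$ (i, Suc k) * (- 1) ^ k) = 0"
  proof (cases i)
    case 0
    have "(\<Sum>k<2*m. X $$ (i, Suc k) * (- 1) ^ k) = 1 / (2 * real m) * (\<Sum>k<2*m. (- 1) ^ k)"
      unfolding sum_distrib_left using 0 by (intro sum.cong) (auto simp: wheel_pinv_entries)
    then show ?thesis by (simp only: alternating_sum_even)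
  next
    case (Suc l)
    then have l: "l < 2 * m" using i by simp
    have "(\<Sum>k<2*m. X $$ (i, Suc k) * (- 1) ^ k)
        = (\<Sum>k<2*m. 1 / (8 * real m) * (- 1) ^ k - 1 / 2 * (rim_lap m $$ (k, l) * (- 1) ^ k))"
      using Suc l by (intro sum.cong) (auto simp: wheel_pinv_entries rim_lap_sym[of l] algebra_simps)
    also have "\<dots> = 0"
      unfolding sum_subtractf sum_distrib_left[symmetric]
      using rim_lap_alternating_column_sum[OF l] by (simp only: alternating_sum_even)
    finally show ?thesis .
  qed
qed

lemma wheel_dist_mat_mult_wheel_pinv: "D * X = 1\<^sub>m (Suc (2 * m)) - P"
proof (rule eq_matI)
  fix i j assume "i < dim_row (1\<^sub>m (Suc (2 * m)) - P)" "j < dim_col (1\<^sub>m (Suc (2 * m)) - P)"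
  then have ij: "i < Suc (2 * m)" "j < Suc (2 * m)" using rim_projection_carrier by auto
  have m0: "real m > 0" using m by simp
  have rim_row: "(\<Sum>k<2*m. rim_dist (2 * m) $$ (l, k)) = 4 * real m - 4" if "l < 2 * m" for l
    using rim_dist_row_sum[of "2 * m" l "\<lambda>_. 1"] m that by simp
  have R: "(1\<^sub>m (Suc (2 * m)) - P) $$ (i, j) = of_bool (i = j) - P $$ (i, j)"
    using ij rim_projection_carrier by simp
  show "(D * X) $$ (i, j) = (1\<^sub>m (Suc (2 * m)) - P) $$ (i, j)"
  proof (cases i)
    case i0: 0
    show ?thesis
    proof (cases j)
      case 0
      with i0 show ?thesis unfolding R mult_entry_split_hub[OF wheel_dist_mat_carrier wheel_pinv_carrier ij]
        using m0 by (simp add: dist_entries wheel_pinv_entries rim_projection_entries)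
    next
      case (Suc l)
      then have l: "l < 2 * m" using ij by simp
      have "(\<Sum>k<2*m. D $$ (i, Suc k) * X $$ (Suc k, j))
          = (\<Sum>k<2*m. 1 / (8 * real m) - rim_lap m $$ (k, l) / 2)"
        using i0 Suc l by (intro sum.cong) (auto simp: dist_entries wheel_pinv_entries)
      also have "\<dots> = 0"
        using m m0 by (simp add: sum_subtractf sum_divide_distrib[symmetric] rim_lap_column_sum[OF _ l])
      finally show ?thesis unfolding R mult_entry_split_hub[OF wheel_dist_mat_carrier wheel_pinv_carrier ij]
        using i0 Suc l by (simp add: dist_entries rim_projection_entries)
    qed
  next
    case i1: (Suc p)
    then have p: "p < 2 * m" using ij by simp
    show ?thesis
    proof (cases j)
      case 0
      have "(\<Sum>k<2*m. D $$ (i, Suc k) * X $$ (Suc k, j))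
          = (\<Sum>k<2*m. rim_dist (2 * m) $$ (p, k)) * (1 / (2 * real m))"
        unfolding sum_distrib_right
        using i1 0 p by (intro sum.cong) (auto simp: dist_entries wheel_pinv_entries)
      also have "\<dots> = 2 - 2 / real m"
        using m0 by (simp only: rim_row[OF p]) (simp add: field_simps)
      finally show ?thesis unfolding R mult_entry_split_hub[OF wheel_dist_mat_carrier wheel_pinv_carrier ij]
        using i1 0 p m0 by (simp add: dist_entries wheel_pinv_entries rim_projection_entries)
    next
      case (Suc l)
      then have l: "l < 2 * m" using ij by simp
      have "(\<Sum>k<2*m. D $$ (i, Suc k) * X $$ (Suc k, j))
          = (\<Sum>k<2*m. rim_dist (2 * m) $$ (p, k) * (1 / (8 * real m))
              - rim_dist (2 * m) $$ (p, k) * rim_lap m $$ (k, l) * (1 / 2))"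
        using i1 Suc l p by (intro sum.cong) (auto simp: dist_entries wheel_pinv_entries algebra_simps)
      also have "\<dots> = (4 * real m - 4) * (1 / (8 * real m))
          - (1 - 2 * of_bool (p = l) + (- 1) ^ (p + l) / real m) * (1 / 2)"
        unfolding sum_subtractf sum_distrib_right[symmetric]
        by (simp only: rim_row[OF p] rim_dist_mult_rim_lap[OF m p l])
      finally have S: "(\<Sum>k<2*m. D $$ (i, Suc k) * X $$ (Suc k, j))
          = (4 * real m - 4) * (1 / (8 * real m))
            - (1 - 2 * of_bool (p = l) + (- 1) ^ (p + l) / real m) * (1 / 2)" .
      show ?thesis unfolding R mult_entry_split_hub[OF wheel_dist_mat_carrier wheel_pinv_carrier ij] S
        using i1 Suc l p m0 by (simp add: dist_entries wheel_pinv_entries rim_projection_entries power_add field_simps)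
    qed
  qed
qed (use wheel_dist_mat_carrier wheel_pinv_carrier rim_projection_carrier in auto)

lemma wheel_pinv_moore_penrose: "is_moore_penrose_inverse D X"
  by (rule moore_penrose_of_symmetric_projection[OF wheel_dist_mat_carrier
        wheel_pinv_carrier rim_projection_carrier wheel_dist_mat_symmetric wheel_pinv_symmetric rim_projection_symmetric
        wheel_dist_mat_mult_wheel_pinv wheel_dist_mat_mult_rim_projection wheel_pinv_mult_rim_projection])

end

theorem theorem1:
  fixes n :: nat
  assumes "n \<ge> 5" and "odd n"
  shows "is_moore_penrose_inverse (wheel_dist_mat n)
    ((- 1 / 2) \<cdot>\<^sub>m special_laplacian n
      + (4 / (real n - 1)) \<cdot>\<^sub>m (w_col n * transpose_mat (w_col n)))"
proof -
  obtain m where "n = 2 * m + 1" using \<open>odd n\<close> by (rule oddE)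
  then have n: "n = Suc (2 * m)" by simp
  then have m: "m \<ge> 2" using \<open>n \<ge> 5\<close> by simp
  have "(- 1 / 2) \<cdot>\<^sub>m special_laplacian n
      + (4 / (real n - 1)) \<cdot>\<^sub>m (w_col n * transpose_mat (w_col n)) = wheel_pinv m"
    using wheel_pinv_eq[of m] m unfolding n by simp
  then show ?thesis using wheel_pinv_moore_penrose[OF m] by (simp add: n)
qed

end
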